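(* Let $(X,d)$ be a nonempty compact metric space. If $(\mathcal{U}_{2\epsilon_n}(A_n),p_{n,n+1})$ is a FAS for $X$, where each term is considered with the opposite order ($C\leq D$ if and only if $D\subseteq C$), then every FASO $(\mathcal{U}_{4\delta_n}(B_n),q_{n,n+1})$ for $X$ is isomorphic to $(\mathcal{U}_{2\epsilon_n}(A_n),p_{n,n+1})$ in pro-$HTop$.
   Context: For $\epsilon>0$, a finite subset $A\subseteq X$ is an $\epsilon$-approximation of $X$ if for every $x\in X$ there is $a\in A$ with $d(x,a)<\epsilon$. $\mathcal{B}(x,\epsilon)$ is the open ball. For $r>0$ and finite $A\subseteq X$, $\mathcal{U}_{r}(A)$ is the finite set of all nonempty $C\subseteq A$ with $\mathrm{diam}(C)<r$. With the opposite order $C\leq D$ iff $D\subseteq C$, it is given the topology whose open sets are the lower sets of $\leq$ (the minimal open neighborhood of $C$ is $\{D : C\subseteq D\}$). A FASO for $X$ is an inverse sequence $(\mathcal{U}_{4\delta_n}(B_n),q_{n,n+1})_{n\in\mathbb{N}}$, $\mathbb{N}=\{1,2,\dots\}$, with the opposite order on each term, where $\delta_1>\mathrm{diam}(X)$, each $B_n$ is a $\delta_n$-approximation of $X$ ($B_1$ may be a single point), $0<\delta_{n+1}<\frac{1}{2}(\delta_n-\sup\{d(x,B_n): x\in X\})$ for all $n$, and $q_{n,n+1}(C)=\bigcup_{x\in C}\mathcal{B}(x,\delta_n)\cap B_n$ (well-defined and continuous). A FAS (finite approximative sequence, or Main Construction) for $X$ is an inverse sequence $(\mathcal{U}_{2\epsilon_n}(A_n),p_{n,n+1})_{n\in\mathbb{N}}$,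 where $\epsilon_1>\mathrm{diam}(X)$, each $A_n$ is an $\epsilon_n$-approximation of $X$, $0<\epsilon_{n+1}<\frac{1}{2}(\epsilon_n-\gamma_n)$ with $\gamma_n=\sup\{d(x,A_n): x\in X\}$, and $p_{n,n+1}:\mathcal{U}_{2\epsilon_{n+1}}(A_{n+1})\to\mathcal{U}_{2\epsilon_n}(A_n)$, $p_{n,n+1}(C)=\bigcup_{c\in C}\{a\in A_n : d(c,a)=d(c,A_n)\}$ (well-defined and inclusion-preserving, hence continuous also for the opposite order). $HTop$ is the category of topological spaces and homotopy classes of continuous maps. For a category $\mathcal{C}$, the category pro-$\mathcal{C}$ has as objects inverse systems in $\mathcal{C}$ over directed sets. A morphism of systems $(X_\lambda,p_{\lambda,\lambda'},\Lambda)\to(Y_\mu,r_{\mu,\mu'},M)$ is a function $\phi:M\to\Lambda$ with morphisms $f_\mu:X_{\phi(\mu)}\to Y_\mu$ such that for $\mu\leq\mu'$ there is $\lambda\geq\phi(\mu),\phi(\mu')$ with $f_\mu\circ p_{\phi(\mu),\lambda}=r_{\mu,\mu'}\circ f_{\mu'}\circ p_{\phi(\mu'),\lambda}$; two such, $(f_\mu,\phi)$ and $(f'_\mu,\phi')$, are equivalent if each $\mu$ admits $\lambda\geq\phi(\mu),\phi'(\mu)$ with $f_\mu\circ p_{\phi(\mu),\lambda}=f'_\mu\circ p_{\phi'(\mu),\lambda}$. Morphisms of pro-$\mathcal{C}$ are equivalence classes; composition is $(g_\nu,\psi)\circ(f_\mu,\phi)=(g_\nu\circ f_{\psi(\nu)},\phi\circ\psi)$.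 An inverse sequence of spaces is regarded as an object of pro-$HTop$ by passing to homotopy classes of bonding maps. *)

theory Defs
  imports "HOL-Analysis.Analysis"
begin

section \<open>Categories\<close>

text \<open>Morphisms are elements of hom sets indexed by pairs of objects. A given value may belong to
  several hom sets, so composition takes the three objects involved as arguments:
  \<open>cmp \<C> x y z g f\<close> is \<open>g \<circ> f\<close> for \<open>f : x \<rightarrow> y\<close> and \<open>g : y \<rightarrow> z\<close>. The record only
  carries the data of a category; it is used for \<open>HTop\<close> and \<open>pro HTop\<close> below.\<close>

record ('o, 'm) cat =
  obj :: "'o set"
  mor :: "'o \<Rightarrow> 'o \<Rightarrow> 'm set"
  cmp :: "'o \<Rightarrow> 'o \<Rightarrow> 'o \<Rightarrow> 'm \<Rightarrow> 'm \<Rightarrow> 'm"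
  ide :: "'o \<Rightarrow> 'm"

definition isomorphic_in :: "('o, 'm) cat \<Rightarrow> 'o \<Rightarrow> 'o \<Rightarrow> bool" where
  "isomorphic_in \<C> x y \<longleftrightarrow> x \<in> obj \<C> \<and> y \<in> obj \<C> \<and>
     (\<exists>f\<in>mor \<C> x y. \<exists>g\<in>mor \<C> y x.
        cmp \<C> x y x g f = ide \<C> x \<and> cmp \<C> y x y f g = ide \<C> y)"


section \<open>The homotopy category of topological spaces\<close>

definition homotopy_rel :: "'p topology \<Rightarrow> 'p topology \<Rightarrow> (('p \<Rightarrow> 'p) \<times> ('p \<Rightarrow> 'p)) set" where
  "homotopy_rel S T = {(f, g). homotopic_with (\<lambda>_. True) S T f g}"

text \<open>Spaces are the topologies on subsets of the type \<open>'p\<close>. Continuous maps are total functions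
  on \<open>'p\<close>; since functions that agree on the source space are homotopic, the values outside
  of it do not affect the homotopy class.\<close>

definition HTop :: "('p topology, ('p \<Rightarrow> 'p) set) cat" where
  "HTop = \<lparr>
     obj = UNIV,
     mor = (\<lambda>S T. {f. continuous_map S T f} // homotopy_rel S T),
     cmp = (\<lambda>S T U G F. homotopy_rel S U `` {g \<circ> f |g f. g \<in> G \<and> f \<in> F}),
     ide = (\<lambda>S. homotopy_rel S S `` {id}) \<rparr>"


section \<open>Pro-categories\<close>

text \<open>\<open>bd S i j\<close> is the bonding morphism from \<open>ob S j\<close> to \<open>ob S i\<close>, for \<open>le S i j\<close>.\<close>

record ('i, 'o, 'm) inv_sys =
  ix :: "'i set"
  le :: "'i \<Rightarrow> 'i \<Rightarrow> bool"
  ob :: "'i \<Rightarrow> 'o"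
  bd :: "'i \<Rightarrow> 'i \<Rightarrow> 'm"

definition directed_set :: "'i set \<Rightarrow> ('i \<Rightarrow> 'i \<Rightarrow> bool) \<Rightarrow> bool" where
  "directed_set I r \<longleftrightarrow> I \<noteq> {} \<and>
     (\<forall>i\<in>I. r i i) \<and>
     (\<forall>i\<in>I. \<forall>j\<in>I. \<forall>k\<in>I. r i j \<and> r j k \<longrightarrow> r i k) \<and>
     (\<forall>i\<in>I. \<forall>j\<in>I. \<exists>k\<in>I. r i k \<and> r j k)"

definition inverse_system :: "('o, 'm) cat \<Rightarrow> ('i, 'o, 'm) inv_sys \<Rightarrow> bool" where
  "inverse_system \<C> S \<longleftrightarrow> directed_set (ix S) (le S) \<and>
     (\<forall>i\<in>ix S. ob S i \<in> obj \<C> \<and> bd S i i = ide \<C> (ob S i)) \<and>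
     (\<forall>i\<in>ix S. \<forall>j\<in>ix S. le S i j \<longrightarrow> bd S i j \<in> mor \<C> (ob S j) (ob S i)) \<and>
     (\<forall>i\<in>ix S. \<forall>j\<in>ix S. \<forall>k\<in>ix S. le S i j \<and> le S j k \<longrightarrow>
        cmp \<C> (ob S k) (ob S j) (ob S i) (bd S i j) (bd S j k) = bd S i k)"

type_synonym ('i, 'm) sys_mor = "('i \<Rightarrow> 'i) \<times> ('i \<Rightarrow> 'm)"

definition sys_morphism ::
    "('o, 'm) cat \<Rightarrow> ('i, 'o, 'm) inv_sys \<Rightarrow> ('i, 'o, 'm) inv_sys \<Rightarrow> ('i, 'm) sys_mor \<Rightarrow> bool" where
  "sys_morphism \<C> S T = (\<lambda>(\<phi>, f).
     (\<forall>m\<in>ix T. \<phi> m \<in> ix S \<and> f m \<in> mor \<C> (ob S (\<phi> m)) (ob T m)) \<and>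
     (\<forall>m\<in>ix T. \<forall>m'\<in>ix T. le T m m' \<longrightarrow>
        (\<exists>l\<in>ix S. le S (\<phi> m) l \<and> le S (\<phi> m') l \<and>
           cmp \<C> (ob S l) (ob S (\<phi> m)) (ob T m) (f m) (bd S (\<phi> m) l) =
           cmp \<C> (ob S l) (ob T m') (ob T m) (bd T m m')
             (cmp \<C> (ob S l) (ob S (\<phi> m')) (ob T m') (f m') (bd S (\<phi> m') l)))))"

definition sys_equiv ::
    "('o, 'm) cat \<Rightarrow> ('i, 'o, 'm) inv_sys \<Rightarrow> ('i, 'o, 'm) inv_sys \<Rightarrow>
     (('i, 'm) sys_mor \<times> ('i, 'm) sys_mor) set" where
  "sys_equiv \<C> S T = {((\<phi>, f), (\<psi>, g)).
     sys_morphism \<C> S T (\<phi>, f) \<and> sys_morphism \<C> S T (\<psi>, g) \<and>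
     (\<forall>m\<in>ix T. \<exists>l\<in>ix S. le S (\<phi> m) l \<and> le S (\<psi> m) l \<and>
        cmp \<C> (ob S l) (ob S (\<phi> m)) (ob T m) (f m) (bd S (\<phi> m) l) =
        cmp \<C> (ob S l) (ob S (\<psi> m)) (ob T m) (g m) (bd S (\<psi> m) l))}"

definition sys_comp ::
    "('o, 'm) cat \<Rightarrow> ('i, 'o, 'm) inv_sys \<Rightarrow> ('i, 'o, 'm) inv_sys \<Rightarrow> ('i, 'o, 'm) inv_sys \<Rightarrow>
     ('i, 'm) sys_mor \<Rightarrow> ('i, 'm) sys_mor \<Rightarrow> ('i, 'm) sys_mor" where
  "sys_comp \<C> S T U = (\<lambda>(\<psi>, g) (\<phi>, f).
     (\<phi> \<circ> \<psi>, \<lambda>n. cmp \<C> (ob S (\<phi> (\<psi> n))) (ob T (\<psi> n)) (ob U n) (g n) (f (\<psi> n))))"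

text \<open>The objects of \<open>pro \<C>\<close> are the inverse systems in \<open>\<C>\<close> indexed by directed sets
  contained in the type \<open>'i\<close>, i.e. \<open>pro \<C>\<close> is a full subcategory of the category of all
  inverse systems in \<open>\<C>\<close>.\<close>

definition pro ::
    "('o, 'm) cat \<Rightarrow> (('i, 'o, 'm) inv_sys, ('i, 'm) sys_mor set) cat" where
  "pro \<C> = \<lparr>
     obj = {S. inverse_system \<C> S},
     mor = (\<lambda>S T. {f. sys_morphism \<C> S T f} // sys_equiv \<C> S T),
     cmp = (\<lambda>S T U G F. sys_equiv \<C> S U `` {sys_comp \<C> S T U g f |g f. g \<in> G \<and> f \<in> F}),
     ide = (\<lambda>S. sys_equiv \<C> S S `` {(id, \<lambda>i. ide \<C> (ob S i))}) \<rparr>"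


section \<open>Inverse sequences of spaces\<close>

text \<open>For maps \<open>p n\<close> from the (n+1)-st to the n-th space,
  \<open>seq_bond p n m = p n \<circ> p (n+1) \<circ> \<dots> \<circ> p (m-1)\<close> for \<open>n \<le> m\<close>.\<close>

fun seq_bond :: "(nat \<Rightarrow> 'p \<Rightarrow> 'p) \<Rightarrow> nat \<Rightarrow> nat \<Rightarrow> 'p \<Rightarrow> 'p" where
  "seq_bond p n 0 = id"
| "seq_bond p n (Suc m) = (if n \<le> m then seq_bond p n m \<circ> p m else id)"

text \<open>The inverse sequence \<open>(T n, p n)\<close>, \<open>n = 1, 2, \<dots>\<close>, as an inverse system in \<open>HTop\<close>;
  the values \<open>T 0\<close> and \<open>p 0\<close> play no role.\<close>

definition seq_system ::
    "(nat \<Rightarrow> 'p topology) \<Rightarrow> (nat \<Rightarrow> 'p \<Rightarrow> 'p) \<Rightarrow> (nat, 'p topology, ('p \<Rightarrow> 'p) set) inv_sys" where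
  "seq_system T p = \<lparr>
     ix = {1..},
     le = (\<le>),
     ob = T,
     bd = (\<lambda>n m. homotopy_rel (T m) (T n) `` {seq_bond p n m}) \<rparr>"


section \<open>Finite approximative sequences\<close>

definition approximation :: "'a::metric_space set \<Rightarrow> real \<Rightarrow> 'a set \<Rightarrow> bool" where
  "approximation X \<epsilon> A \<longleftrightarrow> \<epsilon> > 0 \<and> finite A \<and> A \<subseteq> X \<and> (\<forall>x\<in>X. \<exists>a\<in>A. dist x a < \<epsilon>)"

text \<open>\<open>hyp r A\<close> is the finite set written $\mathcal{U}_r(A)$, and \<open>hyp_space r A\<close> is this set
  with the topology of lower sets for the opposite order (C below D iff D is contained in C).\<close>

definition hyp :: "real \<Rightarrow> 'a::metric_space set \<Rightarrow> 'a set set" where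
  "hyp r A = {C. C \<subseteq> A \<and> C \<noteq> {} \<and> diameter C < r}"

definition lower_topology :: "'p set \<Rightarrow> ('p \<Rightarrow> 'p \<Rightarrow> bool) \<Rightarrow> 'p topology" where
  "lower_topology P r = topology (\<lambda>S. S \<subseteq> P \<and> (\<forall>y\<in>S. \<forall>x\<in>P. r x y \<longrightarrow> x \<in> S))"

lemma openin_lower_topology:
  "openin (lower_topology P r) S \<longleftrightarrow> S \<subseteq> P \<and> (\<forall>y\<in>S. \<forall>x\<in>P. r x y \<longrightarrow> x \<in> S)"
proof -
  have "istopology (\<lambda>S. S \<subseteq> P \<and> (\<forall>y\<in>S. \<forall>x\<in>P. r x y \<longrightarrow> x \<in> S))"
    unfolding istopology_def by blast
  then show ?thesis
    by (simp add: lower_topology_def topology_inverse')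
qed

lemma topspace_lower_topology: "topspace (lower_topology P r) = P"
  unfolding topspace_def openin_lower_topology by blast

definition hyp_space :: "real \<Rightarrow> 'a::metric_space set \<Rightarrow> 'a set topology" where
  "hyp_space r A = lower_topology (hyp r A) (\<lambda>C D. D \<subseteq> C)"

text \<open>All indices start at 1; the values of the sequences at 0 are unconstrained and unused.
  The supremum is that of the distances \<open>d(x, A n)\<close> over the space.\<close>

definition FAS :: "'a::metric_space set \<Rightarrow> (nat \<Rightarrow> real) \<Rightarrow> (nat \<Rightarrow> 'a set) \<Rightarrow> bool" where
  "FAS X \<epsilon> A \<longleftrightarrow> \<epsilon> 1 > diameter X \<and>
     (\<forall>n\<ge>1. approximation X (\<epsilon> n) (A n) \<and>
       0 < \<epsilon> (n+1) \<and> \<epsilon> (n+1) < 1/2 * (\<epsilon> n - (SUP x\<in>X. infdist x (A n))))"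

definition FAS_map :: "(nat \<Rightarrow> 'a::metric_space set) \<Rightarrow> nat \<Rightarrow> 'a set \<Rightarrow> 'a set" where
  "FAS_map A n C = (\<Union>c\<in>C. {a \<in> A n. dist c a = infdist c (A n)})"

definition FAS_system ::
    "(nat \<Rightarrow> real) \<Rightarrow> (nat \<Rightarrow> 'a::metric_space set) \<Rightarrow>
     (nat, 'a set topology, ('a set \<Rightarrow> 'a set) set) inv_sys" where
  "FAS_system \<epsilon> A = seq_system (\<lambda>n. hyp_space (2 * \<epsilon> n) (A n)) (FAS_map A)"

definition FASO :: "'a::metric_space set \<Rightarrow> (nat \<Rightarrow> real) \<Rightarrow> (nat \<Rightarrow> 'a set) \<Rightarrow> bool" where
  "FASO X \<delta> B \<longleftrightarrow> \<delta> 1 > diameter X \<and>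
     (\<forall>n\<ge>1. approximation X (\<delta> n) (B n) \<and>
       0 < \<delta> (n+1) \<and> \<delta> (n+1) < 1/2 * (\<delta> n - (SUP x\<in>X. infdist x (B n))))"

definition FASO_map :: "(nat \<Rightarrow> real) \<Rightarrow> (nat \<Rightarrow> 'a::metric_space set) \<Rightarrow> nat \<Rightarrow> 'a set \<Rightarrow> 'a set" where
  "FASO_map \<delta> B n C = (\<Union>x\<in>C. ball x (\<delta> n) \<inter> B n)"

definition FASO_system ::
    "(nat \<Rightarrow> real) \<Rightarrow> (nat \<Rightarrow> 'a::metric_space set) \<Rightarrow>
     (nat, 'a set topology, ('a set \<Rightarrow> 'a set) set) inv_sys" where
  "FASO_system \<delta> B = seq_system (\<lambda>n. hyp_space (4 * \<delta> n) (B n)) (FASO_map \<delta> B)"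

end

theory Submission
  imports Defs
begin

text \<open>For finite sets \<open>A\<close>, \<open>B\<close> and scales \<open>r\<close>, \<open>s\<close> consider the map from \<open>hyp r A\<close> to \<open>hyp s B\<close>
  that sends \<open>C\<close> to the set of all points of \<open>B\<close> within distance \<open>(s - r) / 2\<close> of \<open>C\<close>. It is well
  defined whenever every point of \<open>A\<close> has a point of \<open>B\<close> that close. Monotone maps \<open>f\<close>, \<open>g\<close> with
  \<open>f C \<subseteq> g C\<close> for all \<open>C\<close> are homotopic, so every monotone map contained in such a thickening is
  homotopic to it; in particular the composite of two thickenings is homotopic to a thickening, as
  the radii add up. Hence the thickenings form a diagram in \<open>HTop\<close> over a preorder. The
  inequalities for \<open>\<epsilon>\<close> and \<open>\<delta>\<close> imply that the bonding maps of both sequences are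
  contained in thickenings, and since the scales tend to 0, each term of one sequence receives a
  thickening from a late term of the other. These maps are mutually inverse in \<open>pro HTop\<close>, because
  all diagrams of thickenings commute.\<close>

section \<open>Well-definedness of composition in pro-categories\<close>

text \<open>In \<open>HTop\<close> and in \<open>pro\<close>, \<open>cmp\<close> saturates the set
  of all composites of representatives. This reduces such a saturation to the class of one chosen
  composite.\<close>

lemma equiv_Image_eq_class:
  assumes "equiv A r" and "x \<in> K" and "\<And>y. y \<in> K \<Longrightarrow> (x, y) \<in> r"
  shows "r `` K = r `` {x}"
proof -
  have "r `` {y} = r `` {x}" if "y \<in> K" for y
    using equiv_class_eq[OF assms(1) assms(3)[OF that]] by simp
  then show ?thesis
    using assms(2) by blast
qed

text \<open>The record \<open>cat\<close> carries no axioms, so the laws are collected here. They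
  are phrased through membership in hom sets; only \<open>ide_in\<close> refers to
  \<open>obj\<close>.\<close>

locale category =
  fixes \<C> :: "('o, 'm) cat"
  assumes ide_in: "x \<in> obj \<C> \<Longrightarrow> ide \<C> x \<in> mor \<C> x x"
    and cmp_in: "f \<in> mor \<C> x y \<Longrightarrow> g \<in> mor \<C> y z \<Longrightarrow> cmp \<C> x y z g f \<in> mor \<C> x z"
    and ide_left: "f \<in> mor \<C> x y \<Longrightarrow> cmp \<C> x y y (ide \<C> y) f = f"
    and ide_right: "f \<in> mor \<C> x y \<Longrightarrow> cmp \<C> x x y f (ide \<C> x) = f"
    and assoc: "f \<in> mor \<C> w x \<Longrightarrow> g \<in> mor \<C> x y \<Longrightarrow> h \<in> mor \<C> y z \<Longrightarrow>
      cmp \<C> w x z (cmp \<C> x y z h g) f = cmp \<C> w y z h (cmp \<C> w x y g f)"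
begin

lemma directed_upper_bound:
  assumes "inverse_system \<C> S" "i \<in> ix S" "j \<in> ix S"
  obtains k where "k \<in> ix S" "le S i k" "le S j k"
  using assms unfolding inverse_system_def directed_set_def by metis

lemma le_trans:
  assumes "inverse_system \<C> S" "i \<in> ix S" "j \<in> ix S" "k \<in> ix S" "le S i j" "le S j k"
  shows "le S i k"
  using assms unfolding inverse_system_def directed_set_def by metis

lemma bd_in:
  assumes "inverse_system \<C> S" "i \<in> ix S" "j \<in> ix S" "le S i j"
  shows "bd S i j \<in> mor \<C> (ob S j) (ob S i)"
  using assms unfolding inverse_system_def by metis

lemma bd_bd:
  assumes "inverse_system \<C> S" "i \<in> ix S" "j \<in> ix S" "k \<in> ix S" "le S i j" "le S j k"
  shows "cmp \<C> (ob S k) (ob S j) (ob S i) (bd S i j) (bd S j k) = bd S i k"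
  using assms unfolding inverse_system_def by metis

text \<open>Bonding maps into stages \<open>i\<close> and \<open>j\<close> from \<open>k'\<close>
  factor through \<open>k\<close>, so an equality at \<open>k\<close> can be precomposed with
  \<open>bd S k k'\<close>. This turns "at some stage" into "at all later stages", so that several
  conditions can be met at a common upper bound.\<close>

lemma equalized_later:
  assumes S: "inverse_system \<C> S"
    and ij: "i \<in> ix S" "j \<in> ix S" and k: "k \<in> ix S" "le S i k" "le S j k"
    and k': "k' \<in> ix S" "le S k k'"
    and f: "f \<in> mor \<C> (ob S i) z" and g: "g \<in> mor \<C> (ob S j) z"
    and eq: "cmp \<C> (ob S k) (ob S i) z f (bd S i k) = cmp \<C> (ob S k) (ob S j) z g (bd S j k)"
  shows "cmp \<C> (ob S k') (ob S i) z f (bd S i k') = cmp \<C> (ob S k') (ob S j) z g (bd S j k')"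
proof -
  have push: "cmp \<C> (ob S k') (ob S a) z h (bd S a k') =
      cmp \<C> (ob S k') (ob S k) z (cmp \<C> (ob S k) (ob S a) z h (bd S a k)) (bd S k k')"
    if "a \<in> ix S" "le S a k" "h \<in> mor \<C> (ob S a) z" for a h
    using assoc[OF bd_in[OF S k(1) k'] bd_in[OF S that(1) k(1) that(2)] that(3)]
      bd_bd[OF S that(1) k(1) k'(1) that(2) k'(2)] by simp
  show ?thesis
    using push[OF ij(1) k(2) f] push[OF ij(2) k(3) g] eq by simp
qed

lemma sys_morphism_in:
  assumes "sys_morphism \<C> S T (\<phi>, f)" "m \<in> ix T"
  shows "\<phi> m \<in> ix S" "f m \<in> mor \<C> (ob S (\<phi> m)) (ob T m)"
  using assms unfolding sys_morphism_def by auto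

text \<open>The definition provides the square at a single index only. Regarding
  \<open>bd T m m'\<close> after \<open>f m'\<close> as one map out of
  \<open>ob S (\<phi> m')\<close> makes \<open>equalized_later\<close> applicable.\<close>

lemma sys_morphism_natural:
  assumes S: "inverse_system \<C> S" and T: "inverse_system \<C> T"
    and f: "sys_morphism \<C> S T (\<phi>, f)"
    and m: "m \<in> ix T" "m' \<in> ix T" "le T m m'"
  obtains l where "l \<in> ix S" "le S (\<phi> m) l" "le S (\<phi> m') l"
    "\<And>k. k \<in> ix S \<Longrightarrow> le S l k \<Longrightarrow>
       cmp \<C> (ob S k) (ob S (\<phi> m)) (ob T m) (f m) (bd S (\<phi> m) k) =
       cmp \<C> (ob S k) (ob T m') (ob T m) (bd T m m')
         (cmp \<C> (ob S k) (ob S (\<phi> m')) (ob T m') (f m') (bd S (\<phi> m') k))"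
proof -
  note fm = sys_morphism_in[OF f m(1)] and fm' = sys_morphism_in[OF f m(2)]
  note b = bd_in[OF T m]
  have shift: "cmp \<C> (ob S k) (ob T m') (ob T m) (bd T m m')
         (cmp \<C> (ob S k) (ob S (\<phi> m')) (ob T m') (f m') (bd S (\<phi> m') k)) =
      cmp \<C> (ob S k) (ob S (\<phi> m')) (ob T m)
        (cmp \<C> (ob S (\<phi> m')) (ob T m') (ob T m) (bd T m m') (f m')) (bd S (\<phi> m') k)"
    if "k \<in> ix S" "le S (\<phi> m') k" for k
    using assoc[OF bd_in[OF S fm'(1) that] fm'(2) b] by simp
  obtain l where l: "l \<in> ix S" "le S (\<phi> m) l" "le S (\<phi> m') l"
    "cmp \<C> (ob S l) (ob S (\<phi> m)) (ob T m) (f m) (bd S (\<phi> m) l) =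
       cmp \<C> (ob S l) (ob T m') (ob T m) (bd T m m')
         (cmp \<C> (ob S l) (ob S (\<phi> m')) (ob T m') (f m') (bd S (\<phi> m') l))"
    using f m unfolding sys_morphism_def split by blast
  show thesis
  proof (rule that[OF l(1-3)])
    fix k assume k: "k \<in> ix S" "le S l k"
    have "le S (\<phi> m') k"
      using le_trans[OF S fm'(1) l(1) k(1) l(3) k(2)] .
    with equalized_later[OF S fm(1) fm'(1) l(1-3) k fm(2) cmp_in[OF fm'(2) b]]
    show "cmp \<C> (ob S k) (ob S (\<phi> m)) (ob T m) (f m) (bd S (\<phi> m) k) =
       cmp \<C> (ob S k) (ob T m') (ob T m) (bd T m m')
         (cmp \<C> (ob S k) (ob S (\<phi> m')) (ob T m') (f m') (bd S (\<phi> m') k))"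
      using l k(1) by (simp add: shift)
  qed
qed

lemma sys_equivD:
  assumes "((\<phi>, f), (\<psi>, g)) \<in> sys_equiv \<C> S T"
  shows "sys_morphism \<C> S T (\<phi>, f)" "sys_morphism \<C> S T (\<psi>, g)"
  using assms unfolding sys_equiv_def by auto

lemma sys_equiv_eventually:
  assumes S: "inverse_system \<C> S"
    and fg: "((\<phi>, f), (\<psi>, g)) \<in> sys_equiv \<C> S T" and m: "m \<in> ix T"
  shows "\<exists>l\<in>ix S. le S (\<phi> m) l \<and> le S (\<psi> m) l \<and> (\<forall>k\<in>ix S. le S l k \<longrightarrow>
       cmp \<C> (ob S k) (ob S (\<phi> m)) (ob T m) (f m) (bd S (\<phi> m) k) =
       cmp \<C> (ob S k) (ob S (\<psi> m)) (ob T m) (g m) (bd S (\<psi> m) k))"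
proof -
  note f = sys_morphism_in[OF sys_equivD(1)[OF fg] m]
    and g = sys_morphism_in[OF sys_equivD(2)[OF fg] m]
  obtain l where l: "l \<in> ix S" "le S (\<phi> m) l" "le S (\<psi> m) l"
       "cmp \<C> (ob S l) (ob S (\<phi> m)) (ob T m) (f m) (bd S (\<phi> m) l) =
       cmp \<C> (ob S l) (ob S (\<psi> m)) (ob T m) (g m) (bd S (\<psi> m) l)"
    using fg m unfolding sys_equiv_def by blast
  show ?thesis
    using l(1-3) equalized_later[OF S f(1) g(1) l(1-3) _ _ f(2) g(2) l(4)] by blast
qed

text \<open>Only transitivity has content: the two equalities persist at later stages, hence both
  hold at an upper bound of their witnesses.\<close>

lemma equiv_sys_equiv:
  assumes S: "inverse_system \<C> S"
  shows "equiv {f. sys_morphism \<C> S T f} (sys_equiv \<C> S T)"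
proof (rule equivI)
  show "sys_equiv \<C> S T \<subseteq> {f. sys_morphism \<C> S T f} \<times> {f. sys_morphism \<C> S T f}"
    unfolding sys_equiv_def by auto
  show "refl_on {f. sys_morphism \<C> S T f} (sys_equiv \<C> S T)"
  proof (rule refl_onI)
    fix F assume "F \<in> {f. sys_morphism \<C> S T f}"
    moreover obtain \<phi> f where "F = (\<phi>, f)" by fastforce
    ultimately have f: "sys_morphism \<C> S T (\<phi>, f)" and F: "F = (\<phi>, f)" by auto
    have "\<exists>l\<in>ix S. le S (\<phi> m) l" if "m \<in> ix T" for m
      using directed_upper_bound[OF S] sys_morphism_in(1)[OF f that] by metis
    with f show "(F, F) \<in> sys_equiv \<C> S T"
      unfolding sys_equiv_def F by auto
  qed
  show "sym (sys_equiv \<C> S T)"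
    unfolding sym_def sys_equiv_def by auto metis
  show "trans (sys_equiv \<C> S T)"
  proof (rule transI)
    fix F G H assume FG: "(F, G) \<in> sys_equiv \<C> S T" and GH: "(G, H) \<in> sys_equiv \<C> S T"
    obtain \<phi> f \<psi> g \<theta> h where F: "F = (\<phi>, f)" and G: "G = (\<psi>, g)" and H: "H = (\<theta>, h)"
      by (metis surj_pair)
    note fg = FG[unfolded F G] and gh = GH[unfolded G H]
    have "\<exists>l\<in>ix S. le S (\<phi> m) l \<and> le S (\<theta> m) l \<and>
        cmp \<C> (ob S l) (ob S (\<phi> m)) (ob T m) (f m) (bd S (\<phi> m) l) =
        cmp \<C> (ob S l) (ob S (\<theta> m)) (ob T m) (h m) (bd S (\<theta> m) l)" if m: "m \<in> ix T" for m
    proof -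
      have ix: "\<phi> m \<in> ix S" "\<theta> m \<in> ix S"
        using sys_morphism_in(1)[OF sys_equivD(1)[OF fg] m]
          sys_morphism_in(1)[OF sys_equivD(2)[OF gh] m] .
      obtain i where i: "i \<in> ix S" "le S (\<phi> m) i" "le S (\<psi> m) i" "\<forall>k\<in>ix S. le S i k \<longrightarrow>
         cmp \<C> (ob S k) (ob S (\<phi> m)) (ob T m) (f m) (bd S (\<phi> m) k) =
         cmp \<C> (ob S k) (ob S (\<psi> m)) (ob T m) (g m) (bd S (\<psi> m) k)"
        using sys_equiv_eventually[OF S fg m] by blast
      obtain j where j: "j \<in> ix S" "le S (\<psi> m) j" "le S (\<theta> m) j" "\<forall>k\<in>ix S. le S j k \<longrightarrow>
         cmp \<C> (ob S k) (ob S (\<psi> m)) (ob T m) (g m) (bd S (\<psi> m) k) =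
         cmp \<C> (ob S k) (ob S (\<theta> m)) (ob T m) (h m) (bd S (\<theta> m) k)"
        using sys_equiv_eventually[OF S gh m] by blast
      obtain k where k: "k \<in> ix S" "le S i k" "le S j k"
        using directed_upper_bound[OF S i(1) j(1)] .
      show ?thesis
        using k i(4)[rule_format, OF k(1,2)] j(4)[rule_format, OF k(1,3)] le_trans[OF S ix(1) i(1) k(1) i(2) k(2)]
          le_trans[OF S ix(2) j(1) k(1) j(3) k(3)] by auto
    qed
    with sys_equivD(1)[OF fg] sys_equivD(2)[OF gh] show "(F, H) \<in> sys_equiv \<C> S T"
      unfolding sys_equiv_def F H by auto
  qed
qed

text \<open>Shared core of the next two lemmas. Far enough out in \<open>S\<close>, naturality of
  \<open>f\<close> replaces \<open>f i\<close> by \<open>bd T i l\<close> after \<open>f l\<close>,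
  the hypothesis \<open>eq\<close> exchanges \<open>g\<close> for \<open>g'\<close>, the equivalence
  exchanges \<open>f l\<close> for \<open>f' l\<close>, and naturality of \<open>f'\<close> leads
  back to \<open>f' j\<close>.\<close>

lemma equalized_precompose:
  assumes S: "inverse_system \<C> S" and T: "inverse_system \<C> T"
    and ff': "((\<phi>, f), (\<phi>', f')) \<in> sys_equiv \<C> S T"
    and i: "i \<in> ix T" and j: "j \<in> ix T" and l: "l \<in> ix T" "le T i l" "le T j l"
    and g: "g \<in> mor \<C> (ob T i) z" and g': "g' \<in> mor \<C> (ob T j) z"
    and eq: "cmp \<C> (ob T l) (ob T i) z g (bd T i l) = cmp \<C> (ob T l) (ob T j) z g' (bd T j l)"
  shows "\<exists>k\<in>ix S. le S (\<phi> i) k \<and> le S (\<phi>' j) k \<and>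
    cmp \<C> (ob S k) (ob S (\<phi> i)) z (cmp \<C> (ob S (\<phi> i)) (ob T i) z g (f i)) (bd S (\<phi> i) k) =
    cmp \<C> (ob S k) (ob S (\<phi>' j)) z (cmp \<C> (ob S (\<phi>' j)) (ob T j) z g' (f' j)) (bd S (\<phi>' j) k)"
proof -
  note f = sys_equivD(1)[OF ff'] and f' = sys_equivD(2)[OF ff']
  note fi = sys_morphism_in[OF f i] and fj = sys_morphism_in[OF f' j]
    and fl = sys_morphism_in[OF f l(1)] and fl' = sys_morphism_in[OF f' l(1)]
  obtain k1 where k1: "k1 \<in> ix S" "le S (\<phi> i) k1" "le S (\<phi> l) k1"
    "\<And>k. k \<in> ix S \<Longrightarrow> le S k1 k \<Longrightarrow>
       cmp \<C> (ob S k) (ob S (\<phi> i)) (ob T i) (f i) (bd S (\<phi> i) k) =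
       cmp \<C> (ob S k) (ob T l) (ob T i) (bd T i l)
         (cmp \<C> (ob S k) (ob S (\<phi> l)) (ob T l) (f l) (bd S (\<phi> l) k))"
    using sys_morphism_natural[OF S T f i l(1,2)] by blast
  obtain k2 where k2: "k2 \<in> ix S" "le S (\<phi>' j) k2" "le S (\<phi>' l) k2"
    "\<And>k. k \<in> ix S \<Longrightarrow> le S k2 k \<Longrightarrow>
       cmp \<C> (ob S k) (ob S (\<phi>' j)) (ob T j) (f' j) (bd S (\<phi>' j) k) =
       cmp \<C> (ob S k) (ob T l) (ob T j) (bd T j l)
         (cmp \<C> (ob S k) (ob S (\<phi>' l)) (ob T l) (f' l) (bd S (\<phi>' l) k))"
    using sys_morphism_natural[OF S T f' j l(1,3)] by blast
  obtain k3 where k3: "k3 \<in> ix S" "le S (\<phi> l) k3" "le S (\<phi>' l) k3"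
    "\<forall>k\<in>ix S. le S k3 k \<longrightarrow>
       cmp \<C> (ob S k) (ob S (\<phi> l)) (ob T l) (f l) (bd S (\<phi> l) k) =
       cmp \<C> (ob S k) (ob S (\<phi>' l)) (ob T l) (f' l) (bd S (\<phi>' l) k)"
    using sys_equiv_eventually[OF S ff' l(1)] by blast
  obtain k0 where k0: "k0 \<in> ix S" "le S k1 k0" "le S k2 k0"
    using directed_upper_bound[OF S k1(1) k2(1)] .
  obtain k where k: "k \<in> ix S" "le S k0 k" "le S k3 k"
    using directed_upper_bound[OF S k0(1) k3(1)] .
  have k12: "le S k1 k" "le S k2 k"
    using le_trans[OF S _ k0(1) k(1) _ k(2)] k1(1) k2(1) k0 by auto
  have above: "le S (\<phi> i) k" "le S (\<phi> l) k" "le S (\<phi>' j) k" "le S (\<phi>' l) k"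
    using le_trans[OF S fi(1) k1(1) k(1)] le_trans[OF S fl(1) k1(1) k(1)]
      le_trans[OF S fj(1) k2(1) k(1)] le_trans[OF S fl'(1) k2(1) k(1)] k1 k2 k12 by auto
  \<comment> \<open>The middle term of the chase: beyond \<open>k3\<close> it can be computed from
    \<open>f l\<close> or from \<open>f' l\<close>.\<close>
  define e where "e = cmp \<C> (ob S k) (ob S (\<phi> l)) (ob T l) (f l) (bd S (\<phi> l) k)"
  have e: "e \<in> mor \<C> (ob S k) (ob T l)"
    unfolding e_def by (rule cmp_in[OF bd_in[OF S fl(1) k(1) above(2)] fl(2)])
  have "cmp \<C> (ob S k) (ob S (\<phi> i)) z (cmp \<C> (ob S (\<phi> i)) (ob T i) z g (f i)) (bd S (\<phi> i) k) =
      cmp \<C> (ob S k) (ob T i) z g (cmp \<C> (ob S k) (ob T l) (ob T i) (bd T i l) e)"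
    using assoc[OF bd_in[OF S fi(1) k(1) above(1)] fi(2) g] k1(4)[OF k(1) k12(1)]
    by (simp add: e_def)
  also have "\<dots> = cmp \<C> (ob S k) (ob T l) z (cmp \<C> (ob T l) (ob T i) z g (bd T i l)) e"
    using assoc[OF e bd_in[OF T i l(1,2)] g] by simp
  also have "\<dots> = cmp \<C> (ob S k) (ob T l) z (cmp \<C> (ob T l) (ob T j) z g' (bd T j l)) e"
    by (simp add: eq)
  also have "\<dots> = cmp \<C> (ob S k) (ob T j) z g' (cmp \<C> (ob S k) (ob T l) (ob T j) (bd T j l) e)"
    by (rule assoc[OF e bd_in[OF T j l(1,3)] g'])
  also have "\<dots> =
      cmp \<C> (ob S k) (ob S (\<phi>' j)) z (cmp \<C> (ob S (\<phi>' j)) (ob T j) z g' (f' j)) (bd S (\<phi>' j) k)"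
    using assoc[OF bd_in[OF S fj(1) k(1) above(3)] fj(2) g'] k2(4)[OF k(1) k12(2)]
      k3(4)[rule_format, OF k(1,3)] by (simp add: e_def)
  finally show ?thesis
    using k(1) above by blast
qed

text \<open>Naturality of the composite is the case of \<open>equalized_precompose\<close> in which
  \<open>f\<close> is paired with itself and \<open>g n\<close> is compared with
  \<open>bd U n n'\<close> after \<open>g n'\<close>.\<close>

lemma sys_morphism_comp:
  assumes S: "inverse_system \<C> S" and T: "inverse_system \<C> T" and U: "inverse_system \<C> U"
    and f: "sys_morphism \<C> S T (\<phi>, f)" and g: "sys_morphism \<C> T U (\<psi>, g)"
  shows "sys_morphism \<C> S U (sys_comp \<C> S T U (\<psi>, g) (\<phi>, f))"
proof -
  have ff: "((\<phi>, f), (\<phi>, f)) \<in> sys_equiv \<C> S T"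
    using equiv_sys_equiv[OF S] f by (simp add: equiv_def refl_on_def)
  have "\<exists>l\<in>ix S. le S (\<phi> (\<psi> n)) l \<and> le S (\<phi> (\<psi> n')) l \<and>
      cmp \<C> (ob S l) (ob S (\<phi> (\<psi> n))) (ob U n)
        (cmp \<C> (ob S (\<phi> (\<psi> n))) (ob T (\<psi> n)) (ob U n) (g n) (f (\<psi> n))) (bd S (\<phi> (\<psi> n)) l) =
      cmp \<C> (ob S l) (ob U n') (ob U n) (bd U n n')
        (cmp \<C> (ob S l) (ob S (\<phi> (\<psi> n'))) (ob U n')
          (cmp \<C> (ob S (\<phi> (\<psi> n'))) (ob T (\<psi> n')) (ob U n') (g n') (f (\<psi> n')))
          (bd S (\<phi> (\<psi> n')) l))"
    if n: "n \<in> ix U" "n' \<in> ix U" "le U n n'" for n n'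
  proof -
    note gn = sys_morphism_in[OF g n(1)] and gn' = sys_morphism_in[OF g n(2)]
    note fn' = sys_morphism_in[OF f gn'(1)]
    note b = bd_in[OF U n]
    obtain l where l: "l \<in> ix T" "le T (\<psi> n) l" "le T (\<psi> n') l"
      "cmp \<C> (ob T l) (ob T (\<psi> n)) (ob U n) (g n) (bd T (\<psi> n) l) =
       cmp \<C> (ob T l) (ob U n') (ob U n) (bd U n n')
         (cmp \<C> (ob T l) (ob T (\<psi> n')) (ob U n') (g n') (bd T (\<psi> n') l))"
      using g n unfolding sys_morphism_def split by blast
    have eq: "cmp \<C> (ob T l) (ob T (\<psi> n)) (ob U n) (g n) (bd T (\<psi> n) l) =
        cmp \<C> (ob T l) (ob T (\<psi> n')) (ob U n)
          (cmp \<C> (ob T (\<psi> n')) (ob U n') (ob U n) (bd U n n') (g n')) (bd T (\<psi> n') l)"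
      using l(4) assoc[OF bd_in[OF T gn'(1) l(1,3)] gn'(2) b] by simp
    obtain k where k: "k \<in> ix S" "le S (\<phi> (\<psi> n)) k" "le S (\<phi> (\<psi> n')) k"
      "cmp \<C> (ob S k) (ob S (\<phi> (\<psi> n))) (ob U n)
        (cmp \<C> (ob S (\<phi> (\<psi> n))) (ob T (\<psi> n)) (ob U n) (g n) (f (\<psi> n))) (bd S (\<phi> (\<psi> n)) k) =
       cmp \<C> (ob S k) (ob S (\<phi> (\<psi> n'))) (ob U n)
        (cmp \<C> (ob S (\<phi> (\<psi> n'))) (ob T (\<psi> n')) (ob U n)
          (cmp \<C> (ob T (\<psi> n')) (ob U n') (ob U n) (bd U n n') (g n')) (f (\<psi> n')))
        (bd S (\<phi> (\<psi> n')) k)"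
      using equalized_precompose[OF S T ff gn(1) gn'(1) l(1-3) gn(2) cmp_in[OF gn'(2) b] eq]
      by blast
    show ?thesis
      using k assoc[OF fn'(2) gn'(2) b] assoc[OF bd_in[OF S fn'(1) k(1,3)] cmp_in[OF fn'(2) gn'(2)] b]
      by auto
  qed
  then show ?thesis
    using sys_morphism_in[OF g] sys_morphism_in[OF f] cmp_in
    unfolding sys_comp_def by (auto simp: sys_morphism_def)
qed

lemma sys_comp_cong:
  assumes S: "inverse_system \<C> S" and T: "inverse_system \<C> T" and U: "inverse_system \<C> U"
    and FF': "(F, F') \<in> sys_equiv \<C> S T" and GG': "(G, G') \<in> sys_equiv \<C> T U"
  shows "(sys_comp \<C> S T U G F, sys_comp \<C> S T U G' F') \<in> sys_equiv \<C> S U"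
proof -
  obtain \<phi> f \<phi>' f' \<psi> g \<psi>' g'
    where F: "F = (\<phi>, f)" "F' = (\<phi>', f')" and G: "G = (\<psi>, g)" "G' = (\<psi>', g')"
    by (metis surj_pair)
  note ff' = FF'[unfolded F] and gg' = GG'[unfolded G]
  note m = sys_equivD[OF ff'] sys_equivD[OF gg']
  have "\<exists>k\<in>ix S. le S (\<phi> (\<psi> n)) k \<and> le S (\<phi>' (\<psi>' n)) k \<and>
      cmp \<C> (ob S k) (ob S (\<phi> (\<psi> n))) (ob U n)
        (cmp \<C> (ob S (\<phi> (\<psi> n))) (ob T (\<psi> n)) (ob U n) (g n) (f (\<psi> n))) (bd S (\<phi> (\<psi> n)) k) =
      cmp \<C> (ob S k) (ob S (\<phi>' (\<psi>' n))) (ob U n)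
        (cmp \<C> (ob S (\<phi>' (\<psi>' n))) (ob T (\<psi>' n)) (ob U n) (g' n) (f' (\<psi>' n)))
        (bd S (\<phi>' (\<psi>' n)) k)"
    if n: "n \<in> ix U" for n
  proof -
    obtain l where l: "l \<in> ix T" "le T (\<psi> n) l" "le T (\<psi>' n) l"
      "cmp \<C> (ob T l) (ob T (\<psi> n)) (ob U n) (g n) (bd T (\<psi> n) l) =
       cmp \<C> (ob T l) (ob T (\<psi>' n)) (ob U n) (g' n) (bd T (\<psi>' n) l)"
      using gg' n unfolding sys_equiv_def by blast
    show ?thesis
      using equalized_precompose[OF S T ff' sys_morphism_in(1)[OF m(3) n]
          sys_morphism_in(1)[OF m(4) n] l(1-3) sys_morphism_in(2)[OF m(3) n]
          sys_morphism_in(2)[OF m(4) n] l(4)] .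
  qed
  with sys_morphism_comp[OF S T U m(1,3)] sys_morphism_comp[OF S T U m(2,4)] show ?thesis
    by (auto simp: F G sys_comp_def sys_equiv_def)
qed

lemma pro_cmp_classes:
  assumes S: "inverse_system \<C> S" and T: "inverse_system \<C> T" and U: "inverse_system \<C> U"
    and F: "sys_morphism \<C> S T F" and G: "sys_morphism \<C> T U G"
  shows "cmp (pro \<C>) S T U (sys_equiv \<C> T U `` {G}) (sys_equiv \<C> S T `` {F}) =
    sys_equiv \<C> S U `` {sys_comp \<C> S T U G F}"
proof -
  let ?K = "{sys_comp \<C> S T U g f |g f. g \<in> sys_equiv \<C> T U `` {G} \<and> f \<in> sys_equiv \<C> S T `` {F}}"
  have "G \<in> sys_equiv \<C> T U `` {G}" "F \<in> sys_equiv \<C> S T `` {F}"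
    using equiv_class_self[OF equiv_sys_equiv[OF T]] equiv_class_self[OF equiv_sys_equiv[OF S]] F G
    by auto
  then have "sys_comp \<C> S T U G F \<in> ?K"
    by blast
  moreover have "(sys_comp \<C> S T U G F, H) \<in> sys_equiv \<C> S U" if "H \<in> ?K" for H
    using that sys_comp_cong[OF S T U] by blast
  ultimately have "sys_equiv \<C> S U `` ?K = sys_equiv \<C> S U `` {sys_comp \<C> S T U G F}"
    by (rule equiv_Image_eq_class[OF equiv_sys_equiv[OF S]])
  then show ?thesis
    by (simp add: pro_def)
qed

section \<open>Isomorphisms in pro-categories from interleavings\<close>

text \<open>A diagram over a preorder commutes, so that no compatibility condition is left to check
  for the interleaving maps.\<close>

lemma interleaving_imp_pro_isomorphic:
  fixes P :: "'k \<Rightarrow> 'k \<Rightarrow> bool" and u :: "'k \<Rightarrow> 'k \<Rightarrow> 'm" and c :: "'k \<Rightarrow> 'o"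
    and S T :: "('i, 'o, 'm) inv_sys"
  assumes P_trans: "\<And>x y z. P x y \<Longrightarrow> P y z \<Longrightarrow> P x z"
    and u_in: "\<And>x y. P x y \<Longrightarrow> u x y \<in> mor \<C> (c x) (c y)"
    and u_cmp: "\<And>x y z. P x y \<Longrightarrow> P y z \<Longrightarrow> cmp \<C> (c x) (c y) (c z) (u y z) (u x y) = u x z"
    and S: "inverse_system \<C> S" and T: "inverse_system \<C> T"
    and obS: "\<And>i. i \<in> ix S \<Longrightarrow> ob S i = c (a i)" and obT: "\<And>i. i \<in> ix T \<Longrightarrow> ob T i = c (b i)"
    and bdS: "\<And>i j. i \<in> ix S \<Longrightarrow> j \<in> ix S \<Longrightarrow> le S i j \<Longrightarrow> P (a j) (a i) \<and> bd S i j = u (a j) (a i)"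
    and bdT: "\<And>i j. i \<in> ix T \<Longrightarrow> j \<in> ix T \<Longrightarrow> le T i j \<Longrightarrow> P (b j) (b i) \<and> bd T i j = u (b j) (b i)"
    and ST: "\<And>m. m \<in> ix T \<Longrightarrow> \<exists>k\<in>ix S. P (a k) (b m)"
    and TS: "\<And>m. m \<in> ix S \<Longrightarrow> \<exists>k\<in>ix T. P (b k) (a m)"
  shows "isomorphic_in (pro \<C>) S T"
proof -
  \<comment> \<open>The components are the diagram maps themselves. It is stated for arbitrary
    \<open>W\<close> and \<open>V\<close> because it serves in both directions.\<close>
  have canonical: "\<exists>\<phi>. (\<forall>m\<in>ix V. \<phi> m \<in> ix W \<and> P (w (\<phi> m)) (v m)) \<and>
      sys_morphism \<C> W V (\<phi>, \<lambda>m. u (w (\<phi> m)) (v m))"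
    if W: "inverse_system \<C> W" and obW: "\<And>i. i \<in> ix W \<Longrightarrow> ob W i = c (w i)"
      and obV: "\<And>i. i \<in> ix V \<Longrightarrow> ob V i = c (v i)"
      and bdW: "\<And>i j. i \<in> ix W \<Longrightarrow> j \<in> ix W \<Longrightarrow> le W i j \<Longrightarrow> P (w j) (w i) \<and> bd W i j = u (w j) (w i)"
      and bdV: "\<And>i j. i \<in> ix V \<Longrightarrow> j \<in> ix V \<Longrightarrow> le V i j \<Longrightarrow> P (v j) (v i) \<and> bd V i j = u (v j) (v i)"
      and WV: "\<And>m. m \<in> ix V \<Longrightarrow> \<exists>k\<in>ix W. P (w k) (v m)"
    for W V :: "('i, 'o, 'm) inv_sys" and w v
  proof -
    obtain \<phi> where \<phi>: "\<And>m. m \<in> ix V \<Longrightarrow> \<phi> m \<in> ix W" "\<And>m. m \<in> ix V \<Longrightarrow> P (w (\<phi> m)) (v m)"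
      using bchoice[of "ix V" "\<lambda>m k. k \<in> ix W \<and> P (w k) (v m)"] WV by blast
    have "\<exists>l\<in>ix W. le W (\<phi> m) l \<and> le W (\<phi> m') l \<and>
        cmp \<C> (ob W l) (ob W (\<phi> m)) (ob V m) (u (w (\<phi> m)) (v m)) (bd W (\<phi> m) l) =
        cmp \<C> (ob W l) (ob V m') (ob V m) (bd V m m')
          (cmp \<C> (ob W l) (ob W (\<phi> m')) (ob V m') (u (w (\<phi> m')) (v m')) (bd W (\<phi> m') l))"
      if m: "m \<in> ix V" "m' \<in> ix V" "le V m m'" for m m'
    proof -
      obtain l where l: "l \<in> ix W" "le W (\<phi> m) l" "le W (\<phi> m') l"
        using directed_upper_bound[OF W \<phi>(1)[OF m(1)] \<phi>(1)[OF m(2)]] .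
      note e = bdW[OF \<phi>(1)[OF m(1)] l(1,2)] bdW[OF \<phi>(1)[OF m(2)] l(1,3)] bdV[OF m]
      \<comment> \<open>With this relation \<open>u_cmp\<close> collapses both sides of the square
        to \<open>u (w l) (v m)\<close>.\<close>
      have "P (w l) (v m')"
        using P_trans e \<phi>(2)[OF m(2)] by blast
      with e show ?thesis
        using l m \<phi> by (auto intro!: bexI[of _ l] simp: obW obV u_cmp)
    qed
    then show ?thesis
      using \<phi> u_in obW obV by (intro exI[of _ \<phi>]) (auto simp: sys_morphism_def)
  qed
  have ide_morphism: "sys_morphism \<C> W W (id, \<lambda>i. ide \<C> (ob W i))"
    if W: "inverse_system \<C> W" for W :: "('i, 'o, 'm) inv_sys"
  proof -
    have "\<exists>l\<in>ix W. le W m l \<and> le W m' l \<and>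
        cmp \<C> (ob W l) (ob W m) (ob W m) (ide \<C> (ob W m)) (bd W m l) =
        cmp \<C> (ob W l) (ob W m') (ob W m) (bd W m m')
          (cmp \<C> (ob W l) (ob W m') (ob W m') (ide \<C> (ob W m')) (bd W m' l))"
      if m: "m \<in> ix W" "m' \<in> ix W" "le W m m'" for m m'
    proof -
      obtain l where l: "l \<in> ix W" "le W m l" "le W m' l"
        using directed_upper_bound[OF W m(1,2)] .
      show ?thesis
        using l bd_bd[OF W m(1,2) l(1) m(3) l(3)] bd_in[OF W m(1) l(1,2)] bd_in[OF W m(2) l(1,3)]
        by (auto intro!: bexI[of _ l] simp: ide_left)
    qed
    moreover have "ide \<C> (ob W m) \<in> mor \<C> (ob W m) (ob W m)" if "m \<in> ix W" for m
      using W that ide_in unfolding inverse_system_def by blast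
    ultimately show ?thesis
      by (auto simp: sys_morphism_def)
  qed
  \<comment> \<open>Both composites of the interleaving maps are instances, with the systems
    exchanged. At any \<open>l\<close> above \<open>m\<close> and \<open>\<phi> (\<psi> m)\<close>
    the round trip becomes \<open>u (w l) (w m)\<close>, which is the bonding map
    \<open>bd W m l\<close>.\<close>
  have inverse: "(sys_comp \<C> W V W (\<psi>, \<lambda>m. u (v (\<psi> m)) (w m)) (\<phi>, \<lambda>m. u (w (\<phi> m)) (v m)),
      (id, \<lambda>i. ide \<C> (ob W i))) \<in> sys_equiv \<C> W W"
    if W: "inverse_system \<C> W" and V: "inverse_system \<C> V"
      and obW: "\<And>i. i \<in> ix W \<Longrightarrow> ob W i = c (w i)" and obV: "\<And>i. i \<in> ix V \<Longrightarrow> ob V i = c (v i)"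
      and bdW: "\<And>i j. i \<in> ix W \<Longrightarrow> j \<in> ix W \<Longrightarrow> le W i j \<Longrightarrow> P (w j) (w i) \<and> bd W i j = u (w j) (w i)"
      and \<phi>: "\<forall>m\<in>ix V. \<phi> m \<in> ix W \<and> P (w (\<phi> m)) (v m)"
        "sys_morphism \<C> W V (\<phi>, \<lambda>m. u (w (\<phi> m)) (v m))"
      and \<psi>: "\<forall>m\<in>ix W. \<psi> m \<in> ix V \<and> P (v (\<psi> m)) (w m)"
        "sys_morphism \<C> V W (\<psi>, \<lambda>m. u (v (\<psi> m)) (w m))"
    for W V :: "('i, 'o, 'm) inv_sys" and w v \<phi> \<psi>
  proof -
    have "\<exists>l\<in>ix W. le W (\<phi> (\<psi> m)) l \<and> le W m l \<and>
        cmp \<C> (ob W l) (ob W (\<phi> (\<psi> m))) (ob W m)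
          (cmp \<C> (ob W (\<phi> (\<psi> m))) (ob V (\<psi> m)) (ob W m)
            (u (v (\<psi> m)) (w m)) (u (w (\<phi> (\<psi> m))) (v (\<psi> m)))) (bd W (\<phi> (\<psi> m)) l) =
        cmp \<C> (ob W l) (ob W m) (ob W m) (ide \<C> (ob W m)) (bd W m l)"
      if m: "m \<in> ix W" for m
    proof -
      have p: "\<psi> m \<in> ix V" "P (v (\<psi> m)) (w m)" "\<phi> (\<psi> m) \<in> ix W" "P (w (\<phi> (\<psi> m))) (v (\<psi> m))"
        using \<phi>(1) \<psi>(1) m by auto
      obtain l where l: "l \<in> ix W" "le W (\<phi> (\<psi> m)) l" "le W m l"
        using directed_upper_bound[OF W p(3) m] .
      note e = bdW[OF p(3) l(1,2)] bdW[OF m l(1,3)]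
      have "P (w (\<phi> (\<psi> m))) (w m)"
        using P_trans p by blast
      with e have "cmp \<C> (ob W l) (ob W (\<phi> (\<psi> m))) (ob W m)
          (cmp \<C> (ob W (\<phi> (\<psi> m))) (ob V (\<psi> m)) (ob W m)
            (u (v (\<psi> m)) (w m)) (u (w (\<phi> (\<psi> m))) (v (\<psi> m)))) (bd W (\<phi> (\<psi> m)) l) = bd W m l"
        using m p l by (simp add: obW obV u_cmp)
      with l ide_left[OF bd_in[OF W m l(1,3)]] show ?thesis
        by (intro bexI[of _ l]) auto
    qed
    with sys_morphism_comp[OF W V W \<phi>(2) \<psi>(2)] ide_morphism[OF W] show ?thesis
      by (auto simp: sys_comp_def sys_equiv_def)
  qed
  obtain \<phi> where \<phi>: "\<forall>m\<in>ix T. \<phi> m \<in> ix S \<and> P (a (\<phi> m)) (b m)"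
    "sys_morphism \<C> S T (\<phi>, \<lambda>m. u (a (\<phi> m)) (b m))"
    using canonical[OF S obS obT bdS bdT ST] by blast
  obtain \<psi> where \<psi>: "\<forall>m\<in>ix S. \<psi> m \<in> ix T \<and> P (b (\<psi> m)) (a m)"
    "sys_morphism \<C> T S (\<psi>, \<lambda>m. u (b (\<psi> m)) (a m))"
    using canonical[OF T obT obS bdT bdS TS] by blast
  let ?F = "sys_equiv \<C> S T `` {(\<phi>, \<lambda>m. u (a (\<phi> m)) (b m))}"
  let ?G = "sys_equiv \<C> T S `` {(\<psi>, \<lambda>m. u (b (\<psi> m)) (a m))}"
  have "cmp (pro \<C>) S T S ?G ?F = ide (pro \<C>) S"
    using pro_cmp_classes[OF S T S \<phi>(2) \<psi>(2)]
      equiv_class_eq[OF equiv_sys_equiv[OF S] inverse[OF S T obS obT bdS \<phi> \<psi>]]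
    by (simp add: pro_def)
  moreover have "cmp (pro \<C>) T S T ?F ?G = ide (pro \<C>) T"
    using pro_cmp_classes[OF T S T \<psi>(2) \<phi>(2)]
      equiv_class_eq[OF equiv_sys_equiv[OF T] inverse[OF T S obT obS bdT \<psi> \<phi>]]
    by (simp add: pro_def)
  moreover have "?F \<in> mor (pro \<C>) S T" "?G \<in> mor (pro \<C>) T S"
    using \<phi>(2) \<psi>(2) by (auto simp: pro_def intro: quotientI)
  moreover have "S \<in> obj (pro \<C>)" "T \<in> obj (pro \<C>)"
    using S T by (auto simp: pro_def)
  ultimately show ?thesis
    unfolding isomorphic_in_def by blast
qed

end

section \<open>Homotopy classes of maps\<close>

lemma equiv_homotopy_rel: "equiv {f. continuous_map S T f} (homotopy_rel S T)"
proof (rule equivI)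
  show "homotopy_rel S T \<subseteq> {f. continuous_map S T f} \<times> {f. continuous_map S T f}"
    unfolding homotopy_rel_def using homotopic_with_imp_continuous_maps by blast
  show "refl_on {f. continuous_map S T f} (homotopy_rel S T)"
    by (rule refl_onI) (simp add: homotopy_rel_def)
  show "sym (homotopy_rel S T)"
    unfolding sym_def homotopy_rel_def using homotopic_with_symD by blast
  show "trans (homotopy_rel S T)"
    unfolding trans_def homotopy_rel_def using homotopic_with_trans by blast
qed

lemma HTop_cmp_classes:
  assumes f: "continuous_map S T f" and g: "continuous_map T U g"
  shows "cmp HTop S T U (homotopy_rel T U `` {g}) (homotopy_rel S T `` {f}) =
    homotopy_rel S U `` {g \<circ> f}"
proof -
  let ?K = "{g' \<circ> f' |g' f'. g' \<in> homotopy_rel T U `` {g} \<and> f' \<in> homotopy_rel S T `` {f}}"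
  have "g \<in> homotopy_rel T U `` {g}" "f \<in> homotopy_rel S T `` {f}"
    using f g by (auto simp: homotopy_rel_def)
  then have "g \<circ> f \<in> ?K"
    by blast
  moreover have "(g \<circ> f, h) \<in> homotopy_rel S U" if "h \<in> ?K" for h
    using that homotopic_compose by (auto simp: homotopy_rel_def)
  ultimately have "homotopy_rel S U `` ?K = homotopy_rel S U `` {g \<circ> f}"
    by (rule equiv_Image_eq_class[OF equiv_homotopy_rel])
  then show ?thesis
    by (simp add: HTop_def)
qed

lemma HTop_class_in_mor: "continuous_map S T f \<Longrightarrow> homotopy_rel S T `` {f} \<in> mor HTop S T"
  by (auto simp: HTop_def intro: quotientI)

lemma HTop_morE:
  assumes "F \<in> mor HTop S T"
  obtains f where "continuous_map S T f" "F = homotopy_rel S T `` {f}"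
  using assms by (auto simp: HTop_def elim: quotientE)

lemma HTop_ide: "ide HTop S = homotopy_rel S S `` {id}"
  by (simp add: HTop_def)

text \<open>After choosing representatives, each law becomes the corresponding law for
  functions.\<close>

interpretation HTop: category HTop
proof
  fix S :: "'a topology"
  show "ide HTop S \<in> mor HTop S S"
    unfolding HTop_ide by (intro HTop_class_in_mor) simp
next
  fix S T U :: "'a topology" and F G
  assume "F \<in> mor HTop S T" "G \<in> mor HTop T U"
  then show "cmp HTop S T U G F \<in> mor HTop S U"
    by (elim HTop_morE) (simp add: HTop_cmp_classes HTop_class_in_mor continuous_map_compose)
next
  fix S T :: "'a topology" and F
  assume "F \<in> mor HTop S T"
  then show "cmp HTop S T T (ide HTop T) F = F"
    by (elim HTop_morE) (simp add: HTop_ide HTop_cmp_classes)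
next
  fix S T :: "'a topology" and F
  assume "F \<in> mor HTop S T"
  then show "cmp HTop S S T F (ide HTop S) = F"
    by (elim HTop_morE) (simp add: HTop_ide HTop_cmp_classes)
next
  fix R S T U :: "'a topology" and F G H
  assume "F \<in> mor HTop R S" "G \<in> mor HTop S T" "H \<in> mor HTop T U"
  then show "cmp HTop R S U (cmp HTop S T U H G) F = cmp HTop R T U H (cmp HTop R S T G F)"
    by (elim HTop_morE) (simp add: HTop_cmp_classes continuous_map_compose comp_assoc)
qed

section \<open>Continuity and homotopy for lower-set topologies\<close>

lemma continuous_map_lower_topologyI:
  assumes "f \<in> P \<rightarrow> Q" "\<And>x y. x \<in> P \<Longrightarrow> y \<in> P \<Longrightarrow> r x y \<Longrightarrow> s (f x) (f y)"
  shows "continuous_map (lower_topology P r) (lower_topology Q s) f"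
  using assms unfolding continuous_map topspace_lower_topology openin_lower_topology
  by (auto simp: image_subset_iff Pi_iff)

text \<open>The homotopy is \<open>f\<close> at time 0 and \<open>g\<close> afterwards; it is continuous because every open set
  that contains \<open>f x\<close> also contains \<open>g x\<close>.\<close>

lemma homotopic_lower_topology:
  assumes f: "continuous_map S (lower_topology Q s) f"
    and g: "continuous_map S (lower_topology Q s) g"
    and le: "\<And>x. x \<in> topspace S \<Longrightarrow> s (g x) (f x)"
  shows "homotopic_with (\<lambda>_. True) S (lower_topology Q s) f g"
proof -
  let ?I = "top_of_set {0..1::real}"
  let ?h = "\<lambda>(t::real, x). if t = 0 then f x else g x"
  have "continuous_map (prod_topology ?I S) (lower_topology Q s) ?h"
    unfolding continuous_map
  proof (intro conjI allI impI)
    show "?h ` topspace (prod_topology ?I S) \<subseteq> topspace (lower_topology Q s)"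
      using f g by (auto simp: continuous_map_def Pi_iff)
    fix V assume V: "openin (lower_topology Q s) V"
    let ?f = "{x \<in> topspace S. f x \<in> V}" and ?g = "{x \<in> topspace S. g x \<in> V}"
    \<comment> \<open>The set \<open>V\<close> is lower, so \<open>f x \<in> V\<close> forces
      \<open>g x \<in> V\<close>; hence the first box may extend over all times. The second is open
      because the time 0 is removed from it.\<close>
    have "{x \<in> topspace (prod_topology ?I S). ?h x \<in> V} = {0..1} \<times> ?f \<union> {0<..1} \<times> ?g"
      using V le g by (fastforce simp: openin_lower_topology continuous_map_def
          topspace_lower_topology Pi_iff split: if_splits)
    moreover have "openin ?I {0<..1}"
      unfolding openin_open by (intro exI[of _ "{0<..}"]) auto
    moreover have "openin ?I {0..1}" "openin S ?f" "openin S ?g"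
      using f g V by (auto simp: openin_continuous_map_preimage)
    ultimately show "openin (prod_topology ?I S) {x \<in> topspace (prod_topology ?I S). ?h x \<in> V}"
      by (auto intro!: openin_Un simp: openin_prod_Times_iff)
  qed
  then show ?thesis
    unfolding homotopic_with_def by (intro exI[of _ ?h]) auto
qed

section \<open>Thickenings\<close>

lemma topspace_hyp_space: "topspace (hyp_space r A) = hyp r A"
  by (simp add: hyp_space_def topspace_lower_topology)

lemma continuous_map_hyp_spaceI:
  assumes "\<And>C. C \<in> hyp r A \<Longrightarrow> f C \<in> hyp s B" "mono f"
  shows "continuous_map (hyp_space r A) (hyp_space s B) f"
  unfolding hyp_space_def using assms
  by (intro continuous_map_lower_topologyI) (auto dest: monoD)

text \<open>In the opposite order the inclusion says that \<open>g C\<close> lies below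
  \<open>f C\<close>, as \<open>homotopic_lower_topology\<close> requires.\<close>

lemma hyp_space_class_eq:
  assumes f: "continuous_map (hyp_space r A) (hyp_space s B) f"
    and g: "continuous_map (hyp_space r A) (hyp_space s B) g"
    and le: "\<And>C. C \<in> hyp r A \<Longrightarrow> f C \<subseteq> g C"
  shows "homotopy_rel (hyp_space r A) (hyp_space s B) `` {f} =
    homotopy_rel (hyp_space r A) (hyp_space s B) `` {g}"
proof -
  have "homotopic_with (\<lambda>_. True) (hyp_space r A) (hyp_space s B) f g"
    using homotopic_lower_topology[OF f[unfolded hyp_space_def[of s]] g[unfolded hyp_space_def[of s]]]
      le by (simp add: topspace_hyp_space flip: hyp_space_def)
  then show ?thesis
    by (intro equiv_class_eq[OF equiv_homotopy_rel]) (simp add: homotopy_rel_def)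
qed

text \<open>Moving two points by at most \<open>(s - r) / 2\<close> each raises their distance by at
  most \<open>s - r\<close>, which takes diameters below \<open>r\<close> to diameters below
  \<open>s\<close>. A scale and its set form one pair so that these pairs can index a
  diagram.\<close>

definition thicken :: "real \<times> 'a::metric_space set \<Rightarrow> real \<times> 'a set \<Rightarrow> 'a set \<Rightarrow> 'a set" where
  "thicken = (\<lambda>(r, A) (s, B) C. {b \<in> B. \<exists>c\<in>C. dist c b \<le> (s - r) / 2})"

text \<open>The transitive relation over which the diagram is indexed. Its last clause keeps
  thickenings of nonempty sets nonempty, and finiteness supplies the boundedness behind the diameter
  estimates.\<close>

definition thickenable :: "real \<times> 'a::metric_space set \<Rightarrow> real \<times> 'a set \<Rightarrow> bool" where
  "thickenable = (\<lambda>(r, A) (s, B). finite A \<and> finite B \<and> (\<forall>a\<in>A. \<exists>b\<in>B. dist a b \<le> (s - r) / 2))"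

abbreviation hyp_sp :: "real \<times> 'a::metric_space set \<Rightarrow> 'a set topology" where
  "hyp_sp \<equiv> \<lambda>(r, A). hyp_space r A"

lemma thickenable_trans:
  assumes "thickenable x y" "thickenable y z"
  shows "thickenable x z"
proof -
  obtain r A s B t D where xyz: "x = (r, A)" "y = (s, B)" "z = (t, D)"
    by (metis surj_pair)
  have "\<exists>d\<in>D. dist a d \<le> (t - r) / 2" if a: "a \<in> A" for a
  proof -
    obtain b where b: "b \<in> B" "dist a b \<le> (s - r) / 2"
      using a assms xyz by (auto simp: thickenable_def)
    then obtain d where "d \<in> D" "dist b d \<le> (t - s) / 2"
      using assms xyz by (auto simp: thickenable_def)
    \<comment> \<open>The radii telescope:
      \<open>(s - r) / 2 + (t - s) / 2 = (t - r) / 2\<close>.\<close>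
    with b dist_triangle[of a d b] show ?thesis
      by (intro bexI[of _ d]) (auto simp: field_simps)
  qed
  then show ?thesis
    using assms xyz by (auto simp: thickenable_def)
qed

text \<open>Replacing two points of \<open>D\<close> by nearby points of \<open>C\<close> gives
  \<open>diameter D \<le> diameter C + (s - r) < s\<close>. Arbitrary nonempty subsets of the
  thickening are allowed so that bonding maps are covered as well.\<close>

lemma subset_thicken_in_hyp:
  assumes "finite A" and "C \<in> hyp r A" and "D \<noteq> {}" and "D \<subseteq> thicken (r, A) (s, B) C"
  shows "D \<in> hyp s B"
proof -
  have C: "C \<subseteq> A" "C \<noteq> {}" "diameter C < r" "bounded C"
    using assms finite_subset finite_imp_bounded by (auto simp: hyp_def)
  let ?d = "diameter C + (s - r)"
  have "dist a b \<le> ?d" if ab: "a \<in> D" "b \<in> D" for a b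
  proof -
    obtain a' b' where "a' \<in> C" "dist a' a \<le> (s - r) / 2" "b' \<in> C" "dist b' b \<le> (s - r) / 2"
      using subsetD[OF assms(4)] ab unfolding thicken_def split mem_Collect_eq by metis
    moreover have "dist a b \<le> dist a' a + dist a' b' + dist b' b"
      using dist_triangle[of a b a'] dist_triangle[of a' b b'] by (simp add: dist_commute)
    moreover have "dist a' b' \<le> diameter C"
      using diameter_bounded_bound[OF C(4)] calculation by blast
    ultimately show ?thesis
      by (simp add: field_simps)
  qed
  then have "diameter D \<le> ?d"
    using assms(3) by (subst diameter_def) (auto intro!: cSUP_least)
  with assms C show ?thesis
    by (auto simp: hyp_def thicken_def)
qed

lemma thicken_ne:
  assumes "thickenable (r, A) (s, B)" and "C \<in> hyp r A"
  shows "thicken (r, A) (s, B) C \<noteq> {}"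
  using assms unfolding thickenable_def thicken_def hyp_def by fastforce

lemma mono_thicken: "mono (thicken x y)"
  by (cases x; cases y) (auto simp: mono_def thicken_def)

lemma continuous_map_subset_thicken:
  assumes "thickenable (r, A) (s, B)" and "mono f"
    and "\<And>C. C \<in> hyp r A \<Longrightarrow> f C \<noteq> {} \<and> f C \<subseteq> thicken (r, A) (s, B) C"
  shows "continuous_map (hyp_space r A) (hyp_space s B) f"
proof (rule continuous_map_hyp_spaceI)
  fix C assume "C \<in> hyp r A"
  with assms(3)[OF this] assms(1) show "f C \<in> hyp s B"
    using subset_thicken_in_hyp[of A C r "f C" s B] by (auto simp: thickenable_def)
qed (rule assms(2))

lemma continuous_map_thicken: "thickenable x y \<Longrightarrow> continuous_map (hyp_sp x) (hyp_sp y) (thicken x y)"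
  by (cases x; cases y) (auto intro!: continuous_map_subset_thicken mono_thicken dest: thicken_ne)

definition thicken_class ::
    "real \<times> 'a::metric_space set \<Rightarrow> real \<times> 'a set \<Rightarrow> ('a set \<Rightarrow> 'a set) set" where
  "thicken_class x y = homotopy_rel (hyp_sp x) (hyp_sp y) `` {thicken x y}"

lemma thicken_class_in_mor: "thickenable x y \<Longrightarrow> thicken_class x y \<in> mor HTop (hyp_sp x) (hyp_sp y)"
  unfolding thicken_class_def by (intro HTop_class_in_mor continuous_map_thicken)

text \<open>Up to homotopy the choice of nearby points does not matter; thus the identity and both
  kinds of bonding maps are recognized as thickenings.\<close>

lemma subset_thicken_class:
  assumes "thickenable (r, A) (s, B)" and "mono f"
    and "\<And>C. C \<in> hyp r A \<Longrightarrow> f C \<noteq> {} \<and> f C \<subseteq> thicken (r, A) (s, B) C"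
  shows "homotopy_rel (hyp_space r A) (hyp_space s B) `` {f} = thicken_class (r, A) (s, B)"
  using hyp_space_class_eq[OF continuous_map_subset_thicken[OF assms]] assms(3)
    continuous_map_thicken[OF assms(1)] by (simp add: thicken_class_def)

text \<open>By the triangle inequality the two-step thickening lies inside the direct one. The
  inclusion may be proper, so the diagram commutes only after passing to homotopy classes.\<close>

lemma thicken_class_cmp:
  assumes "thickenable x y" "thickenable y z"
  shows "cmp HTop (hyp_sp x) (hyp_sp y) (hyp_sp z) (thicken_class y z) (thicken_class x y) =
    thicken_class x z"
proof -
  obtain r A s B t D where xyz: "x = (r, A)" "y = (s, B)" "z = (t, D)"
    by (metis surj_pair)
  have c: "continuous_map (hyp_sp x) (hyp_sp y) (thicken x y)"
    "continuous_map (hyp_sp y) (hyp_sp z) (thicken y z)"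
    "continuous_map (hyp_sp x) (hyp_sp z) (thicken x z)"
    using assms thickenable_trans[OF assms] by (auto intro!: continuous_map_thicken)
  have "(thicken y z \<circ> thicken x y) C \<subseteq> thicken x z C" for C
  proof
    fix d assume "d \<in> (thicken y z \<circ> thicken x y) C"
    then obtain b c where "d \<in> D" "c \<in> C" "dist c b \<le> (s - r) / 2" "dist b d \<le> (t - s) / 2"
      by (auto simp: xyz thicken_def)
    with dist_triangle[of c d b] show "d \<in> thicken x z C"
      by (auto simp: xyz thicken_def field_simps intro!: bexI[of _ c])
  qed
  then show ?thesis
    using hyp_space_class_eq[of r A t D "thicken y z \<circ> thicken x y" "thicken x z"] c(3)
      continuous_map_compose[OF c(1,2)] HTop_cmp_classes[OF c(1,2)]
    by (simp only: thicken_class_def xyz case_prod_conv)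
qed

section \<open>Inverse sequences whose bonding maps lie in thickenings\<close>

lemma seq_bond_self: "seq_bond p n n = id"
  by (cases n) auto

lemma continuous_map_seq_bond:
  assumes "\<And>n. 1 \<le> n \<Longrightarrow> continuous_map (T (Suc n)) (T n) (p n)" and "1 \<le> n" and "n \<le> m"
  shows "continuous_map (T m) (T n) (seq_bond p n m)"
  using assms(3)
proof (induction m rule: dec_induct)
  case base
  show ?case by (simp add: seq_bond_self)
next
  case (step m)
  with assms(2) have "continuous_map (T (Suc m)) (T n) (seq_bond p n m \<circ> p m)"
    by (intro continuous_map_compose[OF assms(1)]) auto
  with step(1) show ?case by (simp only: seq_bond.simps if_True)
qed

lemma seq_bond_comp:
  assumes "n \<le> m" and "m \<le> k"
  shows "seq_bond p n m \<circ> seq_bond p m k = seq_bond p n k"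
  using assms(2)
proof (induction k rule: dec_induct)
  case base
  show ?case by (simp add: seq_bond_self)
next
  case (step k)
  with assms(1) have "n \<le> k" by simp
  with step show ?case
    by (metis seq_bond.simps(2) comp_assoc)
qed

lemma inverse_system_seq_system:
  assumes "\<And>n. 1 \<le> n \<Longrightarrow> continuous_map (T (Suc n)) (T n) (p n)"
  shows "inverse_system HTop (seq_system T p)"
proof -
  note c = continuous_map_seq_bond[of T p, OF assms]
  have "\<exists>k\<ge>1. i \<le> k \<and> j \<le> k" if "1 \<le> i" for i j :: nat
    using that by (intro exI[of _ "max i j"]) auto
  then have "directed_set {1..} ((\<le>) :: nat \<Rightarrow> nat \<Rightarrow> bool)"
    unfolding directed_set_def by auto
  moreover have "homotopy_rel (T m) (T n) `` {seq_bond p n m} \<in> mor HTop (T m) (T n)"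
    if "1 \<le> n" "n \<le> m" for n m
    using HTop_class_in_mor[OF c[OF _ that]] by simp
  moreover have "cmp HTop (T k) (T m) (T n)
      (homotopy_rel (T m) (T n) `` {seq_bond p n m}) (homotopy_rel (T k) (T m) `` {seq_bond p m k}) =
      homotopy_rel (T k) (T n) `` {seq_bond p n k}" if "1 \<le> n" "n \<le> m" "m \<le> k" for n m k
    using HTop_cmp_classes[of "T k" "T m" "seq_bond p m k" "T n" "seq_bond p n m"] c that
    by (simp add: seq_bond_comp)
  ultimately show ?thesis
    by (auto simp: inverse_system_def seq_system_def HTop_ide seq_bond_self HTop_def)
qed

text \<open>What the two constructions have in common: \<open>a n\<close> is the scale and set of
  the n-th term, and \<open>p n\<close> selects, monotonically, some of the points that the
  thickening allows.\<close>

definition thickened_sequence ::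
    "(nat \<Rightarrow> real \<times> 'a::metric_space set) \<Rightarrow> (nat \<Rightarrow> 'a set \<Rightarrow> 'a set) \<Rightarrow> bool" where
  "thickened_sequence a p \<longleftrightarrow> (\<forall>n\<ge>1. thickenable (a (Suc n)) (a n) \<and> mono (p n) \<and>
     (\<forall>C\<in>hyp (fst (a (Suc n))) (snd (a (Suc n))). p n C \<noteq> {} \<and> p n C \<subseteq> thicken (a (Suc n)) (a n) C))"

lemma thickened_sequence_continuous:
  assumes "thickened_sequence a p" "1 \<le> n"
  shows "continuous_map (hyp_sp (a (Suc n))) (hyp_sp (a n)) (p n)"
  using assms continuous_map_subset_thicken[of "fst (a (Suc n))" "snd (a (Suc n))" "fst (a n)" "snd (a n)" "p n"]
  by (simp add: thickened_sequence_def case_prod_beta)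

lemma thickenable_self: "finite A \<Longrightarrow> thickenable (r, A) (r, A)"
  by (auto simp: thickenable_def intro: bexI)

lemma thickened_sequence_bond:
  assumes p: "thickened_sequence a p" and n: "1 \<le> n" "n \<le> m"
  shows "thickenable (a m) (a n) \<and>
    homotopy_rel (hyp_sp (a m)) (hyp_sp (a n)) `` {seq_bond p n m} = thicken_class (a m) (a n)"
  using n(2)
proof (induction m rule: dec_induct)
  case base
  obtain r A where a: "a n = (r, A)" by fastforce
  have A: "finite A"
    using p n(1) a by (auto simp: thickened_sequence_def thickenable_def)
  \<comment> \<open>Equal scales give radius 0.\<close>
  have "C \<subseteq> thicken (r, A) (r, A) C" if "C \<in> hyp r A" for C
    using that by (auto simp: thicken_def hyp_def)
  then have "homotopy_rel (hyp_space r A) (hyp_space r A) `` {id} = thicken_class (r, A) (r, A)"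
    by (intro subset_thicken_class thickenable_self A) (auto simp: mono_def hyp_def)
  with thickenable_self[OF A] show ?case
    by (simp add: a seq_bond_self id_def)
next
  case (step m)
  have s: "thickenable (a (Suc m)) (a m)"
    using p n(1) step.hyps by (auto simp: thickened_sequence_def)
  have "homotopy_rel (hyp_sp (a (Suc m))) (hyp_sp (a m)) `` {p m} = thicken_class (a (Suc m)) (a m)"
    using p n(1) step.hyps
      subset_thicken_class[of "fst (a (Suc m))" "snd (a (Suc m))" "fst (a m)" "snd (a m)" "p m"]
    by (simp add: thickened_sequence_def case_prod_beta)
  moreover note HTop_cmp_classes[OF thickened_sequence_continuous[OF p, of m]
      continuous_map_seq_bond[of "\<lambda>n. hyp_sp (a n)" p n m, OF thickened_sequence_continuous[OF p]]]
  ultimately show ?case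
    using step s n(1) thickenable_trans[OF s] thicken_class_cmp[OF s]
    by (simp add: comp_def)
qed

text \<open>Both sequences sit inside the diagram of thickenings, so mutual cofinality,
  \<open>ab\<close> and \<open>ba\<close>, is all that the interleaving lemma still asks
  for.\<close>

lemma thickened_sequences_isomorphic:
  assumes p: "thickened_sequence a p" and q: "thickened_sequence b q"
    and ab: "\<And>n. 1 \<le> n \<Longrightarrow> \<exists>k\<ge>1. thickenable (a k) (b n)"
    and ba: "\<And>n. 1 \<le> n \<Longrightarrow> \<exists>k\<ge>1. thickenable (b k) (a n)"
  shows "isomorphic_in (pro HTop)
    (seq_system (\<lambda>n. hyp_sp (a n)) p) (seq_system (\<lambda>n. hyp_sp (b n)) q)"
proof (rule HTop.interleaving_imp_pro_isomorphic[where P = thickenable and u = thicken_class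
      and c = hyp_sp and a = a and b = b])
  show "inverse_system HTop (seq_system (\<lambda>n. hyp_sp (a n)) p)"
    "inverse_system HTop (seq_system (\<lambda>n. hyp_sp (b n)) q)"
    using thickened_sequence_continuous p q by (blast intro: inverse_system_seq_system)+
  show "thickenable x z" if "thickenable x y" "thickenable y z" for x y z :: "real \<times> 'a set"
    by (rule thickenable_trans[OF that])
  show "thicken_class x y \<in> mor HTop (hyp_sp x) (hyp_sp y)" if "thickenable x y"
    for x y :: "real \<times> 'a set"
    by (rule thicken_class_in_mor[OF that])
  show "cmp HTop (hyp_sp x) (hyp_sp y) (hyp_sp z) (thicken_class y z) (thicken_class x y) =
      thicken_class x z" if "thickenable x y" "thickenable y z" for x y z :: "real \<times> 'a set"
    by (rule thicken_class_cmp[OF that])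
qed (use ab ba thickened_sequence_bond[OF p] thickened_sequence_bond[OF q] in
    \<open>simp_all add: seq_system_def Bex_def\<close>)

section \<open>Estimates for approximative sequences\<close>

text \<open>Replaces the supremum by a number \<gamma> with the inequalities used later. Positivity
  of the next scale is what makes \<gamma> strictly smaller than the current one.\<close>

lemma FAS_scale:
  assumes X: "X \<noteq> {}" and F: "FAS X \<epsilon> A" and n: "1 \<le> n"
  obtains \<gamma> where "0 \<le> \<gamma>" "\<gamma> < \<epsilon> n" "2 * \<epsilon> (Suc n) \<le> \<epsilon> n - \<gamma>"
    "\<And>x. x \<in> X \<Longrightarrow> infdist x (A n) \<le> \<gamma>" "finite (A n)" "A n \<noteq> {}" "A n \<subseteq> X"
proof -
  let ?\<gamma> = "SUP x\<in>X. infdist x (A n)"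
  have A: "approximation X (\<epsilon> n) (A n)" "0 < \<epsilon> (Suc n)" "\<epsilon> (Suc n) < 1/2 * (\<epsilon> n - ?\<gamma>)"
    using F n by (auto simp: FAS_def)
  \<comment> \<open>A real \<open>SUP\<close> bounds its family only when the family is bounded
    above; here the approximation property gives the bound \<open>\<epsilon> n\<close>.\<close>
  have "bdd_above ((\<lambda>x. infdist x (A n)) ` X)"
    using A(1) by (intro bdd_aboveI[of _ "\<epsilon> n"])
      (fastforce simp: approximation_def intro: infdist_le2 less_imp_le)
  then have \<gamma>: "infdist x (A n) \<le> ?\<gamma>" if "x \<in> X" for x
    using that by (intro cSUP_upper)
  moreover obtain x where "x \<in> X" using X by blast
  ultimately have "0 \<le> ?\<gamma>"
    using infdist_nonneg order_trans by blast
  moreover have "finite (A n)" "A n \<noteq> {}" "A n \<subseteq> X"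
    using A(1) X by (auto simp: approximation_def)
  ultimately show thesis
    using that[of ?\<gamma>] \<gamma> A by simp
qed

lemma finite_infdist_attained:
  assumes "finite A" "A \<noteq> {}"
  obtains a where "a \<in> A" "dist x a = infdist x A"
proof -
  have "infdist x A = Min (dist x ` A)"
    using assms by (simp add: infdist_notempty cInf_eq_Min)
  with Min_in[of "dist x ` A"] assms have "infdist x A \<in> dist x ` A"
    by simp
  with that show thesis by (metis imageE)
qed

text \<open>As \<gamma> is nonnegative, each scale is at most half the preceding one. The exponent
  is shifted because the sequence starts at 1.\<close>

lemma FAS_tendsto_0:
  assumes X: "X \<noteq> {}" and F: "FAS X \<epsilon> A" and "0 < t"
  shows "\<exists>k\<ge>1. \<epsilon> k < t"
proof -
  have bound: "\<epsilon> (Suc k) \<le> \<epsilon> 1 * (1/2) ^ k" for k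
  proof (induction k)
    case (Suc k)
    obtain \<gamma> where "0 \<le> \<gamma>" "2 * \<epsilon> (Suc (Suc k)) \<le> \<epsilon> (Suc k) - \<gamma>"
      by (rule FAS_scale[OF X F, of "Suc k"]) auto
    with Suc show ?case by simp
  qed simp
  have "(\<lambda>k. \<epsilon> 1 * (1/2) ^ k) \<longlonglongrightarrow> \<epsilon> 1 * 0"
    by (intro tendsto_intros LIMSEQ_realpow_zero) auto
  then have "eventually (\<lambda>k. \<epsilon> 1 * (1/2) ^ k < t) sequentially"
    using \<open>0 < t\<close> by (simp add: order_tendstoD(2))
  then obtain k where "\<epsilon> 1 * (1/2) ^ k < t"
    by (auto simp: eventually_sequentially)
  with bound[of k] show ?thesis
    by (intro exI[of _ "Suc k"]) auto
qed

text \<open>Points of \<open>X\<close> are within \<gamma> of \<open>B n\<close>, so the radius must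
  be at least \<gamma>. Since \<open>2 \<le> d\<close>, it suffices that
  \<open>c * \<epsilon> k\<close> is below \<open>2 * (\<delta> n - \<gamma>)\<close>, a positive
  number. The factors \<open>c\<close> and \<open>d\<close> stand for the 2 and 4 of the two
  constructions.\<close>

lemma FAS_thickenable_later:
  assumes X: "X \<noteq> {}" and F: "FAS X \<epsilon> A" and G: "FAS X \<delta> B"
    and "0 < c" and "2 \<le> d" and n: "1 \<le> n"
  shows "\<exists>k\<ge>1. thickenable (c * \<epsilon> k, A k) (d * \<delta> n, B n)"
proof -
  obtain \<gamma> where \<gamma>: "0 \<le> \<gamma>" "\<gamma> < \<delta> n" "\<And>x. x \<in> X \<Longrightarrow> infdist x (B n) \<le> \<gamma>"
    "finite (B n)" "B n \<noteq> {}"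
    using FAS_scale[OF X G n] by metis
  obtain k where k: "1 \<le> k" "\<epsilon> k < 2 * (\<delta> n - \<gamma>) / c"
    using FAS_tendsto_0[OF X F, of "2 * (\<delta> n - \<gamma>) / c"] \<gamma> \<open>0 < c\<close> by auto
  have "2 * \<delta> n \<le> d * \<delta> n"
    using \<gamma> \<open>2 \<le> d\<close> by (intro mult_right_mono) auto
  moreover have "c * \<epsilon> k < 2 * (\<delta> n - \<gamma>)"
    using k \<open>0 < c\<close> by (simp add: field_simps)
  ultimately have "\<gamma> \<le> (d * \<delta> n - c * \<epsilon> k) / 2"
    by simp
  moreover have "finite (A k)" "A k \<subseteq> X"
    using FAS_scale[OF X F k(1)] by metis+
  moreover have "\<exists>b\<in>B n. dist x b \<le> \<gamma>" if "x \<in> X" for x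
    using finite_infdist_attained[OF \<gamma>(4,5), of x] \<gamma>(3)[OF that] by metis
  ultimately have "\<exists>b\<in>B n. dist a b \<le> (d * \<delta> n - c * \<epsilon> k) / 2" if "a \<in> A k" for a
    using that by (meson order_trans subsetD)
  with \<gamma>(4) \<open>finite (A k)\<close> have "thickenable (c * \<epsilon> k, A k) (d * \<delta> n, B n)"
    by (simp add: thickenable_def)
  with k(1) show ?thesis by blast
qed

lemma FAS_thickened_sequence:
  assumes X: "X \<noteq> {}" and F: "FAS X \<epsilon> A"
  shows "thickened_sequence (\<lambda>n. (2 * \<epsilon> n, A n)) (FAS_map A)"
  unfolding thickened_sequence_def
proof (intro allI impI conjI ballI)
  fix n :: nat assume n: "1 \<le> n"
  obtain \<gamma> where \<gamma>: "0 \<le> \<gamma>" "2 * \<epsilon> (Suc n) \<le> \<epsilon> n - \<gamma>"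
    "\<And>x. x \<in> X \<Longrightarrow> infdist x (A n) \<le> \<gamma>" "finite (A n)" "A n \<noteq> {}"
    using FAS_scale[OF X F n] by metis
  have A: "finite (A (Suc n))" "A (Suc n) \<subseteq> X" and pos: "0 < \<epsilon> (Suc n)"
    using F n by (auto simp: FAS_def approximation_def)
  \<comment> \<open>The radius is \<open>\<epsilon> n - \<epsilon> (Suc n)\<close>, and a nearest
    point is at distance at most
    \<open>\<gamma> \<le> \<epsilon> n - 2 * \<epsilon> (Suc n)\<close>.\<close>
  have near: "dist x a \<le> (2 * \<epsilon> n - 2 * \<epsilon> (Suc n)) / 2" if "x \<in> X" "dist x a = infdist x (A n)" for x a
    using \<gamma>(2) \<gamma>(3)[OF that(1)] that(2) pos by simp
  have att: "\<exists>a\<in>A n. dist x a = infdist x (A n)" for x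
    using finite_infdist_attained[OF \<gamma>(4,5)] by metis
  show "thickenable (2 * \<epsilon> (Suc n), A (Suc n)) (2 * \<epsilon> n, A n)"
    using A \<gamma>(4) att near unfolding thickenable_def split by (meson subsetD)
  show "mono (FAS_map A n)"
    by (auto simp: FAS_map_def mono_def)
  fix C assume "C \<in> hyp (fst (2 * \<epsilon> (Suc n), A (Suc n))) (snd (2 * \<epsilon> (Suc n), A (Suc n)))"
  then have C: "C \<subseteq> X" "C \<noteq> {}"
    using A by (auto simp: hyp_def)
  show "FAS_map A n C \<noteq> {}"
    using C att by (auto simp: FAS_map_def)
  show "FAS_map A n C \<subseteq> thicken (2 * \<epsilon> (Suc n), A (Suc n)) (2 * \<epsilon> n, A n) C"
    unfolding FAS_map_def thicken_def split using C(1) near by blast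
qed

text \<open>The constructions differ in the hyperspace scale and the bonding maps, which enter only
  in the systems; the scale estimates therefore transfer.\<close>

lemma FASO_iff_FAS: "FASO X \<delta> B \<longleftrightarrow> FAS X \<delta> B"
  by (simp add: FASO_def FAS_def)

lemma FASO_thickened_sequence:
  assumes X: "X \<noteq> {}" and F: "FASO X \<delta> B"
  shows "thickened_sequence (\<lambda>n. (4 * \<delta> n, B n)) (FASO_map \<delta> B)"
  unfolding thickened_sequence_def
proof (intro allI impI conjI ballI)
  fix n :: nat assume n: "1 \<le> n"
  obtain \<gamma> where \<gamma>: "0 \<le> \<gamma>" "2 * \<delta> (Suc n) \<le> \<delta> n - \<gamma>"
    using FAS_scale[OF X F[unfolded FASO_iff_FAS] n] by metis
  have B: "finite (B (Suc n))" "B (Suc n) \<subseteq> X" "finite (B n)" "\<forall>x\<in>X. \<exists>b\<in>B n. dist x b < \<delta> n"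
    using F n by (auto simp: FASO_def approximation_def)
  \<comment> \<open>The radius is \<open>2 * \<delta> n - 2 * \<delta> (Suc n)\<close>, which is at
    least \<open>\<delta> n\<close> because scales at least halve.\<close>
  have near: "dist x b \<le> (4 * \<delta> n - 4 * \<delta> (Suc n)) / 2" if "dist x b < \<delta> n" for x b
    using \<gamma> that by simp
  show "thickenable (4 * \<delta> (Suc n), B (Suc n)) (4 * \<delta> n, B n)"
    using B near unfolding thickenable_def split by (meson subsetD)
  show "mono (FASO_map \<delta> B n)"
    by (auto simp: FASO_map_def mono_def)
  fix C assume "C \<in> hyp (fst (4 * \<delta> (Suc n), B (Suc n))) (snd (4 * \<delta> (Suc n), B (Suc n)))"
  then have C: "C \<subseteq> X" "C \<noteq> {}"
    using B by (auto simp: hyp_def)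
  show "FASO_map \<delta> B n C \<noteq> {}"
  proof -
    obtain c where c: "c \<in> C" "c \<in> X"
      using C by blast
    with B(4) obtain b where "b \<in> B n" "dist c b < \<delta> n"
      by blast
    with c have "b \<in> FASO_map \<delta> B n C"
      by (auto simp: FASO_map_def)
    then show ?thesis by blast
  qed
  show "FASO_map \<delta> B n C \<subseteq> thicken (4 * \<delta> (Suc n), B (Suc n)) (4 * \<delta> n, B n) C"
  proof
    fix b assume "b \<in> FASO_map \<delta> B n C"
    then obtain c where "b \<in> B n" "c \<in> C" "dist c b < \<delta> n"
      by (auto simp: FASO_map_def)
    with near[of c b] show "b \<in> thicken (4 * \<delta> (Suc n), B (Suc n)) (4 * \<delta> n, B n) C"
      by (auto simp: thicken_def)
  qed
qed

theorem theorem4p2: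
  fixes X :: "'a::metric_space set"
    and \<epsilon> \<delta> :: "nat \<Rightarrow> real" and A B :: "nat \<Rightarrow> 'a set"
  assumes "compact X" and "X \<noteq> {}"
    and "FAS X \<epsilon> A"
    and "FASO X \<delta> B"
  shows "isomorphic_in (pro HTop) (FASO_system \<delta> B) (FAS_system \<epsilon> A)"
  \<comment> \<open>The factors 4 and 2 give thickenings from late FASO terms to FAS terms; 2 and 4
    give the reverse direction.\<close>
  using thickened_sequences_isomorphic[OF FASO_thickened_sequence[OF assms(2,4)]
      FAS_thickened_sequence[OF assms(2,3)]]
    FAS_thickenable_later[OF assms(2) assms(4)[unfolded FASO_iff_FAS] assms(3), of 4 2]
    FAS_thickenable_later[OF assms(2,3) assms(4)[unfolded FASO_iff_FAS], of 2 4]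
  by (simp add: FASO_system_def FAS_system_def)

end
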